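(* Let $X$ be a complex Banach space and let $G$ be a locally compact group. If $G$ has robust Banach property (T) with respect to the class $\{\mathbb{C}\oplus X\}$, where $\mathbb{C}\oplus X$ carries the $\ell_2$ norm $\|(z,v)\|=(|z|^2+\|v\|^2)^{1/2}$, then $G$ has property $F_X$.
   Context: Banach spaces are complex. A representation of $G$ on a Banach space $X$ is a group homomorphism $\pi$ from $G$ to the invertible bounded operators on $X$ that is continuous for the strong operator topology; $X^\pi=\{v\in X:\pi(g)v=v\ \forall g\in G\}$. For $f\in C_c(G)$ (continuous compactly supported functions), $\pi(f)v=\int_G f(g)\pi(g)v\,d\mu(g)$ with $\mu$ a left Haar measure. For a family $\mathcal{F}$ of representations, $\|f\|_{\mathcal{F}}=\sup_{\pi\in\mathcal{F}}\|\pi(f)\|$ and $C_{\mathcal{F}}(G)$ is the completion of $C_c(G)$ for this (semi)norm; each $\pi\in\mathcal{F}$ extends to $C_{\mathcal{F}}(G)$. A projection on a subspace $M$ is a bounded idempotent with image $M$. A length over $G$ is a continuous function $l:G\to[0,\infty)$ with $l(g)=l(g^{-1})$ and $l(g_1g_2)\le l(g_1)+l(g_2)$. For a class $\mathcal{E}$ of Banach spaces, $\mathcal{F}(\mathcal{E},l)$ is the family of representations $\pi$ of $G$ on some $X\in\mathcal{E}$ with $\|\pi(g)\|\le e^{l(g)}$ for all $g\in G$. $G$ has robust Banach property (T) with respect to $\mathcal{E}$ if for every length $l$ over $G$ there are $s_0>0$ and a sequence of real-valued $f_n\in C_c(G)$ with $f_n(g)=f_n(g^{-1})$ and $\int_G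 f_n\,d\mu=1$ for all $n$, such that $(f_n)$ converges in $C_{\mathcal{F}(\mathcal{E},s_0l)}(G)$ to some $p$ and for every $\pi\in\mathcal{F}(\mathcal{E},s_0l)$ (on $X$), $\pi(p)$ is a projection on $X^\pi$. $G$ has property $F_X$ if every continuous affine isometric action of $G$ on $X$ has a fixed point; here "affine" means that the linear part of the action is $\mathbb{C}$-linear. *)

theory Defs
  imports "HOL-Analysis.Analysis"
begin

section \<open>Complex Banach spaces\<close>

class complex_banach = banach +
  fixes scaleC :: "complex \<Rightarrow> 'a \<Rightarrow> 'a" (infixr "*\<^sub>C" 75)
  assumes scaleC_add_right: "c *\<^sub>C (x + y) = c *\<^sub>C x + c *\<^sub>C y"
    and scaleC_add_left: "(c + d) *\<^sub>C x = c *\<^sub>C x + d *\<^sub>C x"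
    and scaleC_scaleC: "c *\<^sub>C (d *\<^sub>C x) = (c * d) *\<^sub>C x"
    and scaleC_one: "1 *\<^sub>C x = x"
    and scaleC_of_real: "complex_of_real r *\<^sub>C x = r *\<^sub>R x"
    and norm_scaleC: "norm (c *\<^sub>C x) = cmod c * norm x"

instantiation complex :: complex_banach
begin

definition scaleC_complex :: "complex \<Rightarrow> complex \<Rightarrow> complex"
  where "scaleC_complex c z = c * z"

instance
  by standard
    (auto simp: scaleC_complex_def algebra_simps norm_mult scaleR_conv_of_real)

end

text \<open>The library norm on a product is the \<open>\<ell>\<^sub>2\<close> norm, so the type \<open>complex \<times> 'x\<close> is
  the Banach space \<open>\<complex> \<oplus> X\<close> with norm \<open>(|z|\<^sup>2 + \<parallel>v\<parallel>\<^sup>2)\<^sup>1\<^sup>/\<^sup>2\<close>.\<close>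

instantiation prod :: (complex_banach, complex_banach) complex_banach
begin

definition scaleC_prod :: "complex \<Rightarrow> 'a \<times> 'b \<Rightarrow> 'a \<times> 'b"
  where "scaleC_prod c x = (c *\<^sub>C fst x, c *\<^sub>C snd x)"

instance
proof
  fix c d :: complex and r :: real and x y :: "'a \<times> 'b"
  show "c *\<^sub>C (x + y) = c *\<^sub>C x + c *\<^sub>C y"
    by (simp add: scaleC_prod_def scaleC_add_right)
  show "(c + d) *\<^sub>C x = c *\<^sub>C x + d *\<^sub>C x"
    by (simp add: scaleC_prod_def scaleC_add_left)
  show "c *\<^sub>C (d *\<^sub>C x) = (c * d) *\<^sub>C x"
    by (simp add: scaleC_prod_def scaleC_scaleC)
  show "1 *\<^sub>C x = x"
    by (simp add: scaleC_prod_def scaleC_one)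
  show "complex_of_real r *\<^sub>C x = r *\<^sub>R x"
    by (simp add: scaleC_prod_def scaleC_of_real prod_eq_iff)
  have "(cmod c * norm (fst x))\<^sup>2 + (cmod c * norm (snd x))\<^sup>2
      = (cmod c)\<^sup>2 * ((norm (fst x))\<^sup>2 + (norm (snd x))\<^sup>2)"
    by (simp add: power_mult_distrib algebra_simps)
  then show "norm (c *\<^sub>C x) = cmod c * norm x"
    by (simp add: scaleC_prod_def norm_prod_def norm_scaleC real_sqrt_mult)
qed

end

definition clinear_map :: "('a::complex_banach \<Rightarrow> 'b::complex_banach) \<Rightarrow> bool"
  where "clinear_map T \<longleftrightarrow>
    (\<forall>x y. T (x + y) = T x + T y) \<and> (\<forall>c x. T (c *\<^sub>C x) = c *\<^sub>C T x)"

definition bounded_clinear_map :: "('a::complex_banach \<Rightarrow> 'b::complex_banach) \<Rightarrow> bool"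
  where "bounded_clinear_map T \<longleftrightarrow> clinear_map T \<and> bounded_linear T"

definition projection_on :: "('a::complex_banach \<Rightarrow> 'a) \<Rightarrow> 'a set \<Rightarrow> bool"
  where "projection_on P M \<longleftrightarrow> bounded_clinear_map P \<and> P \<circ> P = P \<and> range P = M"


section \<open>Bochner integral in arbitrary Banach spaces\<close>

text \<open>The library predicate \<open>has_bochner_integral\<close> is restricted to second countable target
  spaces.  The definition below is the same one without that sort constraint.\<close>

definition has_bochner_integral_in ::
    "'g measure \<Rightarrow> ('g \<Rightarrow> 'b::real_normed_vector) \<Rightarrow> 'b \<Rightarrow> bool"
  where "has_bochner_integral_in M f x \<longleftrightarrow>
    f \<in> borel_measurable M \<and>
    (\<exists>s. (\<forall>i. Bochner_Integration.simple_bochner_integrable M (s i)) \<and>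
      (\<lambda>i::nat. \<integral>\<^sup>+g. ennreal (norm (f g - s i g)) \<partial>M) \<longlonglongrightarrow> 0 \<and>
      (\<lambda>i. Bochner_Integration.simple_bochner_integral M (s i)) \<longlonglongrightarrow> x)"

definition bochner_integral_in ::
    "'g measure \<Rightarrow> ('g \<Rightarrow> 'b::real_normed_vector) \<Rightarrow> 'b"
  where "bochner_integral_in M f = (THE x. has_bochner_integral_in M f x)"


section \<open>Groups\<close>

text \<open>Topological groups are types of class \<^class>\<open>topological_group_add\<close>; the group law is
  written additively but is not assumed commutative.\<close>

definition left_haar_measure ::
    "('g::{topological_group_add, t2_space}) measure \<Rightarrow> bool"
  where "left_haar_measure \<mu> \<longleftrightarrow>
    sets \<mu> = sets borel \<and>
    emeasure \<mu> UNIV \<noteq> 0 \<and>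
    (\<forall>g. \<forall>A\<in>sets borel. emeasure \<mu> ((+) g ` A) = emeasure \<mu> A) \<and>
    (\<forall>K. compact K \<longrightarrow> emeasure \<mu> K < \<infinity>) \<and>
    (\<forall>A\<in>sets borel. emeasure \<mu> A = (INF U\<in>{U. open U \<and> A \<subseteq> U}. emeasure \<mu> U)) \<and>
    (\<forall>U. open U \<longrightarrow> emeasure \<mu> U = (SUP K\<in>{K. compact K \<and> K \<subseteq> U}. emeasure \<mu> K))"

definition Cc :: "('g::topological_space \<Rightarrow> complex) set"
  where "Cc = {f. continuous_on UNIV f \<and> compact (closure {g. f g \<noteq> 0})}"

definition length_on :: "('g::topological_group_add \<Rightarrow> real) \<Rightarrow> bool"
  where "length_on l \<longleftrightarrow>
    continuous_on UNIV l \<and> (\<forall>g. 0 \<le> l g) \<and> (\<forall>g. l (- g) = l g) \<and>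
    (\<forall>g h. l (g + h) \<le> l g + l h)"


section \<open>Representations\<close>

text \<open>Invertibility of each \<open>\<pi> g\<close>, with bounded inverse \<open>\<pi> (- g)\<close>, is implied by the
  homomorphism conditions.\<close>

definition representation ::
    "('g::topological_group_add \<Rightarrow> 'b::complex_banach \<Rightarrow> 'b) \<Rightarrow> bool"
  where "representation \<pi> \<longleftrightarrow>
    (\<forall>g. bounded_clinear_map (\<pi> g)) \<and>
    \<pi> 0 = id \<and> (\<forall>g h. \<pi> (g + h) = \<pi> g \<circ> \<pi> h) \<and>
    (\<forall>v. continuous_on UNIV (\<lambda>g. \<pi> g v))"

definition invariant_vectors :: "('g \<Rightarrow> 'b \<Rightarrow> 'b) \<Rightarrow> 'b set"
  where "invariant_vectors \<pi> = {v. \<forall>g. \<pi> g v = v}"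

text \<open>The operator \<open>\<pi>(f)\<close>.\<close>

definition rep_op ::
    "'g measure \<Rightarrow> ('g \<Rightarrow> 'b::complex_banach \<Rightarrow> 'b) \<Rightarrow> ('g \<Rightarrow> complex) \<Rightarrow> 'b \<Rightarrow> 'b"
  where "rep_op \<mu> \<pi> f v = bochner_integral_in \<mu> (\<lambda>g. f g *\<^sub>C \<pi> g v)"

text \<open>The family \<open>\<F>({'b}, l)\<close>, for the class whose only member is the Banach space \<open>'b\<close>.\<close>

definition reps_bounded_by ::
    "('g::topological_group_add \<Rightarrow> real) \<Rightarrow> ('g \<Rightarrow> 'b::complex_banach \<Rightarrow> 'b) set"
  where "reps_bounded_by l = {\<pi>. representation \<pi> \<and> (\<forall>g. onorm (\<pi> g) \<le> exp (l g))}"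

text \<open>The supremum is taken in the reals.  For the families \<^const>\<open>reps_bounded_by\<close> and
  \<open>f \<in> Cc\<close> the set is nonempty (trivial representation) and bounded by \<open>\<integral>|f| e\<^sup>l d\<mu>\<close>.\<close>

definition family_norm ::
    "'g measure \<Rightarrow> ('g \<Rightarrow> 'b::complex_banach \<Rightarrow> 'b) set \<Rightarrow> ('g \<Rightarrow> complex) \<Rightarrow> real"
  where "family_norm \<mu> F f = (SUP \<pi>\<in>F. onorm (rep_op \<mu> \<pi> f))"

definition family_dist ::
    "'g measure \<Rightarrow> ('g \<Rightarrow> 'b::complex_banach \<Rightarrow> 'b) set \<Rightarrow>
     ('g \<Rightarrow> complex) \<Rightarrow> ('g \<Rightarrow> complex) \<Rightarrow> real"
  where "family_dist \<mu> F f h = family_norm \<mu> F (\<lambda>g. f g - h g)"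


section \<open>Completion of a pseudometric space\<close>

text \<open>The completion of \<open>(V, d)\<close> as the set of Cauchy sequences modulo sequences at
  distance tending to zero.\<close>

definition cauchy_seqs :: "'v set \<Rightarrow> ('v \<Rightarrow> 'v \<Rightarrow> real) \<Rightarrow> (nat \<Rightarrow> 'v) set"
  where "cauchy_seqs V d =
    {u. (\<forall>n. u n \<in> V) \<and> (\<forall>e>0. \<exists>N. \<forall>m\<ge>N. \<forall>n\<ge>N. d (u m) (u n) < e)}"

definition cauchy_rel ::
    "'v set \<Rightarrow> ('v \<Rightarrow> 'v \<Rightarrow> real) \<Rightarrow> ((nat \<Rightarrow> 'v) \<times> (nat \<Rightarrow> 'v)) set"
  where "cauchy_rel V d =
    {(u, w). u \<in> cauchy_seqs V d \<and> w \<in> cauchy_seqs V d \<and> (\<lambda>n. d (u n) (w n)) \<longlonglongrightarrow> 0}"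

definition completion :: "'v set \<Rightarrow> ('v \<Rightarrow> 'v \<Rightarrow> real) \<Rightarrow> (nat \<Rightarrow> 'v) set set"
  where "completion V d = cauchy_seqs V d // cauchy_rel V d"

definition completion_embed ::
    "'v set \<Rightarrow> ('v \<Rightarrow> 'v \<Rightarrow> real) \<Rightarrow> 'v \<Rightarrow> (nat \<Rightarrow> 'v) set"
  where "completion_embed V d x = cauchy_rel V d `` {\<lambda>_. x}"

definition completion_dist ::
    "('v \<Rightarrow> 'v \<Rightarrow> real) \<Rightarrow> (nat \<Rightarrow> 'v) set \<Rightarrow> (nat \<Rightarrow> 'v) set \<Rightarrow> real"
  where "completion_dist d p q = (THE r. \<forall>u\<in>p. \<forall>w\<in>q. (\<lambda>n. d (u n) (w n)) \<longlonglongrightarrow> r)"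

definition converges_in_completion ::
    "'v set \<Rightarrow> ('v \<Rightarrow> 'v \<Rightarrow> real) \<Rightarrow> (nat \<Rightarrow> 'v) \<Rightarrow> (nat \<Rightarrow> 'v) set \<Rightarrow> bool"
  where "converges_in_completion V d f p \<longleftrightarrow>
    p \<in> completion V d \<and> (\<lambda>n. completion_dist d (completion_embed V d (f n)) p) \<longlonglongrightarrow> 0"

text \<open>The value \<open>\<pi>(p)\<close> of the continuous extension of \<open>\<pi>\<close> to the completion: the limit in
  operator norm of \<open>\<pi>(u n)\<close>, for the Cauchy sequences \<open>u\<close> representing \<open>p\<close>.\<close>

definition rep_ext ::
    "'g measure \<Rightarrow> ('g \<Rightarrow> 'b::complex_banach \<Rightarrow> 'b) \<Rightarrow> (nat \<Rightarrow> 'g \<Rightarrow> complex) set \<Rightarrow> 'b \<Rightarrow> 'b"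
  where "rep_ext \<mu> \<pi> p =
    (THE T. bounded_clinear_map T \<and>
      (\<forall>u\<in>p. (\<lambda>n. onorm (\<lambda>v. rep_op \<mu> \<pi> (u n) v - T v)) \<longlonglongrightarrow> 0))"


section \<open>Robust Banach property (T) and property \<open>F\<^sub>X\<close>\<close>

text \<open>Robust Banach property (T) of \<open>'g\<close> with respect to the class whose only member is the
  Banach space \<open>'b\<close>; \<open>\<mu>\<close> is a left Haar measure.\<close>

definition robust_banach_T ::
    "('g::{topological_group_add, t2_space}) measure \<Rightarrow> 'b::complex_banach itself \<Rightarrow> bool"
  where "robust_banach_T \<mu> E \<longleftrightarrow>
    (\<forall>l::'g \<Rightarrow> real. length_on l \<longrightarrow>
      (\<exists>s\<^sub>0>0. \<exists>f :: nat \<Rightarrow> 'g \<Rightarrow> complex.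
        let F = reps_bounded_by (\<lambda>g. s\<^sub>0 * l g) :: ('g \<Rightarrow> 'b \<Rightarrow> 'b) set in
        (\<forall>n. f n \<in> Cc \<and> (\<forall>g. f n g \<in> \<real>) \<and> (\<forall>g. f n g = f n (- g)) \<and>
             (\<integral>g. f n g \<partial>\<mu>) = 1) \<and>
        (\<exists>p. converges_in_completion Cc (family_dist \<mu> F) f p \<and>
             (\<forall>\<pi>\<in>F. projection_on (rep_ext \<mu> \<pi> p) (invariant_vectors \<pi>)))))"

definition affine_isometric_action ::
    "('g::topological_group_add \<Rightarrow> 'x::complex_banach \<Rightarrow> 'x) \<Rightarrow> bool"
  where "affine_isometric_action \<alpha> \<longleftrightarrow>
    \<alpha> 0 = id \<and> (\<forall>g h. \<alpha> (g + h) = \<alpha> g \<circ> \<alpha> h) \<and>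
    (\<forall>g. \<exists>L b. clinear_map L \<and> (\<forall>v. \<alpha> g v = L v + b)) \<and>
    (\<forall>g v w. dist (\<alpha> g v) (\<alpha> g w) = dist v w) \<and>
    continuous_on UNIV (\<lambda>(g, v). \<alpha> g v)"

definition property_F ::
    "'g::topological_group_add itself \<Rightarrow> 'x::complex_banach itself \<Rightarrow> bool"
  where "property_F G X \<longleftrightarrow>
    (\<forall>\<alpha>::'g \<Rightarrow> 'x \<Rightarrow> 'x. affine_isometric_action \<alpha> \<longrightarrow> (\<exists>v. \<forall>g. \<alpha> g v = v))"

end

theory Submission
  imports Defs
begin

text \<open>The property returns s only after the length has been fixed, so the representation is
  built afterwards, with its off-diagonal entry scaled by that same s; its growth then fits under
  the exponent s l(g) however small s is. The larger part of the work lies in giving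
  \<open>rep_ext\<close> its meaning. X need not be separable, and Borel maps into a nonseparable
  normed space need not have a Borel sum. Integrals are therefore handled through estimates on
  simple approximants, and the measurability of a sum is always read off from the particular
  integrand that it equals. Moreover \<pi>(f), the distance to p and \<pi>(p) are definite
  descriptions and the family norm is a real supremum, so each needs existence and uniqueness, or
  boundedness, before its value can be used.\<close>

text \<open>Write an affine isometric action as \<open>\<alpha>(g)v = L(g)v + b(g)\<close>.  Then \<open>l(g) = \<parallel>b(g)\<parallel>\<close> is a
  length, and for \<open>s > 0\<close> the operators \<open>\<pi>(g)(z, v) = (z, L(g)v + s z b(g))\<close> form a representation on
  \<open>\<complex> \<oplus> X\<close> with \<open>\<parallel>\<pi>(g)\<parallel> \<le> 1 + s l(g) \<le> e\<^bsup>s l(g)\<^esup>\<close>.  For \<open>s = s\<^sub>0\<close> the projection \<open>\<pi>(p)\<close> sends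
  \<open>(1, 0)\<close> to an invariant vector whose first coordinate is \<open>lim \<integral>f\<^sub>n = 1\<close>; if this vector
  is \<open>(1, w)\<close>, then \<open>w / s\<^sub>0\<close> is fixed by \<open>\<alpha>\<close>.\<close>

section \<open>The Bochner integral without second countability\<close>

text \<open>\<open>s\<close> takes finitely many values, so the domain splits into finitely many
  measurable pieces on each of which the function is a continuous function of \<open>f\<close>
  alone. This avoids measurability of the difference \<open>f - s\<close> itself.\<close>

lemma borel_measurable_norm_diff_simple_function:
  fixes f s :: "'a \<Rightarrow> 'b::real_normed_vector"
  assumes f: "f \<in> borel_measurable M" and s: "simple_function M s"
  shows "(\<lambda>x. norm (f x - s x)) \<in> borel_measurable M"
proof (rule measurable_compose_countable'[where f = "\<lambda>y x. norm (f x - y)" and I = "s ` space M"])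
  show "(\<lambda>x. norm (f x - y)) \<in> borel_measurable M" for y
    using f by (rule measurable_compose)
      (intro borel_measurable_continuous_onI continuous_intros)
  show "s \<in> measurable M (count_space (s ` space M))"
    using s by (subst measurable_count_space_eq2)
      (auto simp: simple_function_def)
  show "countable (s ` space M)"
    using s by (auto simp: simple_function_def countable_finite)
qed

lemma norm_simple_bochner_integral_le:
  fixes s :: "'a \<Rightarrow> 'b::real_normed_vector"
  assumes s: "Bochner_Integration.simple_bochner_integrable M s"
  shows "ennreal (norm (Bochner_Integration.simple_bochner_integral M s)) \<le> (\<integral>\<^sup>+x. norm (s x) \<partial>M)"
proof -
  have "Bochner_Integration.simple_bochner_integrable M (\<lambda>x. norm (s x))"
    using simple_bochner_integrable_compose2[of "\<lambda>x y. norm x" M s s] s by auto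
  then show ?thesis
    using simple_bochner_integral_norm_bound[OF s]
    by (subst simple_bochner_integral_eq_nn_integral[symmetric]) (auto intro: ennreal_leI)
qed

text \<open>The basic estimate of the section: two approximants of \<open>f\<close> are close in
  mean because both are close to \<open>f\<close>. With \<open>t = 0\<close> it bounds the norm of
  an integral; with two members of one approximating sequence it gives the Cauchy property.\<close>

lemma simple_bochner_integral_diff_le:
  fixes f s t :: "'a \<Rightarrow> 'b::real_normed_vector"
  assumes f: "f \<in> borel_measurable M"
    and s: "Bochner_Integration.simple_bochner_integrable M s" and t: "Bochner_Integration.simple_bochner_integrable M t"
  shows "ennreal (norm (Bochner_Integration.simple_bochner_integral M s - Bochner_Integration.simple_bochner_integral M t)) \<le>
    (\<integral>\<^sup>+x. norm (f x - s x) \<partial>M) + (\<integral>\<^sup>+x. norm (f x - t x) \<partial>M)"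
proof -
  have st: "simple_function M s" "simple_function M t"
    using s t by (auto elim: simple_bochner_integrable.cases)
  have "ennreal (norm (Bochner_Integration.simple_bochner_integral M s - Bochner_Integration.simple_bochner_integral M t))
      \<le> (\<integral>\<^sup>+x. norm (s x - t x) \<partial>M)"
    using norm_simple_bochner_integral_le[of M "\<lambda>x. s x - t x"]
      simple_bochner_integrable_compose2[of "(-)" M s t] s t
    by (simp add: simple_bochner_integral_diff)
  also have "\<dots> \<le> (\<integral>\<^sup>+x. ennreal (norm (f x - s x)) + ennreal (norm (f x - t x)) \<partial>M)"
  proof (intro nn_integral_mono)
    fix x
    have "norm (s x - t x) \<le> norm (f x - s x) + norm (f x - t x)"
      by (metis dual_order.refl norm_diff_triangle_le norm_minus_commute)
    then show "ennreal (norm (s x - t x)) \<le> ennreal (norm (f x - s x)) + ennreal (norm (f x - t x))"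
      by (simp flip: ennreal_plus add: ennreal_leI)
  qed
  also have "\<dots> = (\<integral>\<^sup>+x. norm (f x - s x) \<partial>M) + (\<integral>\<^sup>+x. norm (f x - t x) \<partial>M)"
    using st f by (intro nn_integral_add measurable_compose[OF _ measurable_ennreal]
      borel_measurable_norm_diff_simple_function)
  finally show ?thesis .
qed

lemma has_bochner_integral_in_norm_le:
  assumes "has_bochner_integral_in M f x"
  shows "ennreal (norm x) \<le> (\<integral>\<^sup>+g. norm (f g) \<partial>M)"
proof -
  obtain s where f: "f \<in> borel_measurable M"
    and s: "\<And>i::nat. Bochner_Integration.simple_bochner_integrable M (s i)"
    and lim: "(\<lambda>i. \<integral>\<^sup>+g. norm (f g - s i g) \<partial>M) \<longlonglongrightarrow> 0"
    and x: "(\<lambda>i. Bochner_Integration.simple_bochner_integral M (s i)) \<longlonglongrightarrow> x"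
    using assms unfolding has_bochner_integral_in_def by auto
  \<comment> \<open>The zero function serves as second approximant: its distance to \<open>f\<close>
    in mean is the integral of the norm of \<open>f\<close>.\<close>
  have z: "Bochner_Integration.simple_bochner_integrable M (\<lambda>_. 0 :: 'b)"
    by (auto simp: simple_bochner_integrable.simps)
  have S0: "Bochner_Integration.simple_bochner_integral M (\<lambda>_. 0 :: 'b) = 0"
    by (simp add: simple_bochner_integral_def image_constant_conv)
  have "ennreal (norm (Bochner_Integration.simple_bochner_integral M (s i)))
      \<le> (\<integral>\<^sup>+g. norm (f g - s i g) \<partial>M) + (\<integral>\<^sup>+g. norm (f g) \<partial>M)" for i
    using simple_bochner_integral_diff_le[OF f s[of i] z]
    by (simp add: S0)
  moreover have "(\<lambda>i. ennreal (norm (Bochner_Integration.simple_bochner_integral M (s i)))) \<longlonglongrightarrow> ennreal (norm x)"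
    by (intro tendsto_ennrealI tendsto_norm x)
  moreover have "(\<lambda>i. (\<integral>\<^sup>+g. norm (f g - s i g) \<partial>M) + (\<integral>\<^sup>+g. norm (f g) \<partial>M))
      \<longlonglongrightarrow> 0 + (\<integral>\<^sup>+g. norm (f g) \<partial>M)"
    by (intro tendsto_add lim tendsto_const)
  ultimately show ?thesis
    by (metis (no_types, lifting) LIMSEQ_le add.left_neutral)
qed

text \<open>Measurability of the sum is a hypothesis because measurability of the summands does not
  imply it in a nonseparable space. The approximating sequences simply add.\<close>

lemma has_bochner_integral_in_add:
  assumes "has_bochner_integral_in M f x" "has_bochner_integral_in M h y"
    and fh: "(\<lambda>g. f g + h g) \<in> borel_measurable M"
  shows "has_bochner_integral_in M (\<lambda>g. f g + h g) (x + y)"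
proof -
  obtain s where f: "f \<in> borel_measurable M"
    and s: "\<And>i::nat. Bochner_Integration.simple_bochner_integrable M (s i)"
    and slim: "(\<lambda>i. \<integral>\<^sup>+g. norm (f g - s i g) \<partial>M) \<longlonglongrightarrow> 0"
    and x: "(\<lambda>i. Bochner_Integration.simple_bochner_integral M (s i)) \<longlonglongrightarrow> x"
    using assms(1) unfolding has_bochner_integral_in_def by auto
  obtain t where h: "h \<in> borel_measurable M"
    and t: "\<And>i::nat. Bochner_Integration.simple_bochner_integrable M (t i)"
    and tlim: "(\<lambda>i. \<integral>\<^sup>+g. norm (h g - t i g) \<partial>M) \<longlonglongrightarrow> 0"
    and y: "(\<lambda>i. Bochner_Integration.simple_bochner_integral M (t i)) \<longlonglongrightarrow> y"
    using assms(2) unfolding has_bochner_integral_in_def by auto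
  have st: "simple_function M (s i)" "simple_function M (t i)" for i
    using s t by (auto elim: simple_bochner_integrable.cases)
  have le: "(\<integral>\<^sup>+g. norm (f g + h g - (s i g + t i g)) \<partial>M)
      \<le> (\<integral>\<^sup>+g. norm (f g - s i g) \<partial>M) + (\<integral>\<^sup>+g. norm (h g - t i g) \<partial>M)" for i
  proof -
    have "(\<integral>\<^sup>+g. norm (f g + h g - (s i g + t i g)) \<partial>M)
        \<le> (\<integral>\<^sup>+g. ennreal (norm (f g - s i g)) + ennreal (norm (h g - t i g)) \<partial>M)"
      by (auto intro!: nn_integral_mono norm_diff_triangle_ineq simp flip: ennreal_plus)
    also have "\<dots> = (\<integral>\<^sup>+g. norm (f g - s i g) \<partial>M) + (\<integral>\<^sup>+g. norm (h g - t i g) \<partial>M)"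
      using st f h by (intro nn_integral_add measurable_compose[OF _ measurable_ennreal]
        borel_measurable_norm_diff_simple_function)
    finally show ?thesis .
  qed
  have "(\<lambda>i. \<integral>\<^sup>+g. norm (f g + h g - (s i g + t i g)) \<partial>M) \<longlonglongrightarrow> 0"
    using tendsto_add[OF slim tlim]
    by (intro tendsto_sandwich[OF _ always_eventually[OF allI[OF le]] tendsto_const]) simp_all
  moreover have "(\<lambda>i. Bochner_Integration.simple_bochner_integral M (\<lambda>g. s i g + t i g)) \<longlonglongrightarrow> x + y"
    using tendsto_add[OF x y] s t by (simp add: simple_bochner_integral_add)
  moreover have "Bochner_Integration.simple_bochner_integrable M (\<lambda>g. s i g + t i g)" for i
    using s t by (simp add: simple_bochner_integrable_compose2)
  ultimately show ?thesis
    using fh unfolding has_bochner_integral_in_def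
    by (intro conjI exI[of _ "\<lambda>i g. s i g + t i g"]) auto
qed

text \<open>In contrast to sums, measurability is automatic here, \<open>T\<close> being continuous.
  The lemma is applied to negation, to complex scaling and to the first coordinate of a
  product.\<close>

lemma has_bochner_integral_in_bounded_linear:
  assumes T: "bounded_linear T" and "has_bochner_integral_in M f x"
  shows "has_bochner_integral_in M (\<lambda>g. T (f g)) (T x)"
proof -
  interpret T: bounded_linear T by fact
  obtain s where f: "f \<in> borel_measurable M"
    and s: "\<And>i::nat. Bochner_Integration.simple_bochner_integrable M (s i)"
    and lim: "(\<lambda>i. \<integral>\<^sup>+g. norm (f g - s i g) \<partial>M) \<longlonglongrightarrow> 0"
    and x: "(\<lambda>i. Bochner_Integration.simple_bochner_integral M (s i)) \<longlonglongrightarrow> x"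
    using assms(2) unfolding has_bochner_integral_in_def by auto
  have sf: "simple_function M (s i)" for i
    using s by (auto elim: simple_bochner_integrable.cases)
  obtain K where K: "K > 0" "\<And>y z. norm (T y - T z) \<le> K * norm (y - z)"
    using T.pos_bounded by (auto simp: T.diff[symmetric] mult.commute)
  have le: "(\<integral>\<^sup>+g. norm (T (f g) - T (s i g)) \<partial>M) \<le> K * (\<integral>\<^sup>+g. norm (f g - s i g) \<partial>M)" for i
  proof -
    have "(\<integral>\<^sup>+g. norm (T (f g) - T (s i g)) \<partial>M) \<le> (\<integral>\<^sup>+g. ennreal K * norm (f g - s i g) \<partial>M)"
      using K by (intro nn_integral_mono) (auto simp: ennreal_mult[symmetric])
    also have "\<dots> = K * (\<integral>\<^sup>+g. norm (f g - s i g) \<partial>M)"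
      using f sf by (intro nn_integral_cmult measurable_compose[OF _ measurable_ennreal]
        borel_measurable_norm_diff_simple_function)
    finally show ?thesis .
  qed
  have "(\<lambda>i. ennreal K * (\<integral>\<^sup>+g. norm (f g - s i g) \<partial>M)) \<longlonglongrightarrow> 0"
    using ennreal_tendsto_cmult[OF _ lim, of "ennreal K"] by simp
  then have "(\<lambda>i. \<integral>\<^sup>+g. norm (T (f g) - T (s i g)) \<partial>M) \<longlonglongrightarrow> 0"
    by (rule tendsto_sandwich[OF _ always_eventually[OF allI[OF le]] tendsto_const, rotated]) simp
  moreover have "(\<lambda>g. T (f g)) \<in> borel_measurable M"
    using f by (rule measurable_compose)
      (intro borel_measurable_continuous_onI T.continuous_on continuous_on_id)
  moreover have "Bochner_Integration.simple_bochner_integrable M (\<lambda>g. T (s i g))" for i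
    using simple_bochner_integrable_compose2[of "\<lambda>y z. T y" M "s i" "s i"] s by (auto simp: T.zero)
  moreover have "(\<lambda>i. Bochner_Integration.simple_bochner_integral M (\<lambda>g. T (s i g))) \<longlonglongrightarrow> T x"
    using T.tendsto[OF x] s by (simp add: simple_bochner_integral_linear T.linear_axioms)
  ultimately show ?thesis
    unfolding has_bochner_integral_in_def by (intro conjI exI[of _ "\<lambda>i g. T (s i g)"]) auto
qed

lemma has_bochner_integral_in_unique:
  assumes x: "has_bochner_integral_in M f x" and y: "has_bochner_integral_in M f y"
  shows "x = y"
proof -
  \<comment> \<open>This sum is the constant 0, so the measurability demanded by additivity is
    trivial, and the norm bound forces \<open>x - y\<close> to vanish.\<close>
  have "has_bochner_integral_in M (\<lambda>g. f g + - f g) (x + - y)"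
    using has_bochner_integral_in_bounded_linear[OF bounded_linear_minus[OF bounded_linear_ident] y]
    by (intro has_bochner_integral_in_add[OF x]) auto
  from has_bochner_integral_in_norm_le[OF this] show ?thesis
    by (simp add: ennreal_eq_0_iff)
qed

lemma bochner_integral_in_eq:
  "has_bochner_integral_in M f x \<Longrightarrow> bochner_integral_in M f = x"
  unfolding bochner_integral_in_def by (blast intro: the_equality has_bochner_integral_in_unique)

text \<open>Links scalar integrals to the ordinary integral in which the normalisation of the
  functions \<open>f n\<close> is stated.\<close>

lemma has_bochner_integral_in_iff:
  fixes f :: "'a \<Rightarrow> 'b::{real_normed_vector, second_countable_topology}"
  shows "has_bochner_integral_in M f x \<longleftrightarrow> has_bochner_integral M f x"
  unfolding has_bochner_integral_in_def has_bochner_integral.simps by auto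

text \<open>The image of \<open>K\<close> is totally bounded, so \<open>f\<close> is a uniform limit of simple functions
  supported in \<open>K\<close>.\<close>

lemma continuous_simple_approximation:
  fixes f :: "'a::t2_space \<Rightarrow> 'b::real_normed_vector"
  assumes M: "sets M = sets borel" and f: "continuous_on UNIV f"
    and K: "compact K" "emeasure M K < \<infinity>" and out: "\<And>g. g \<notin> K \<Longrightarrow> f g = 0" and e: "0 < e"
  shows "\<exists>s. Bochner_Integration.simple_bochner_integrable M s \<and> (\<forall>g. norm (f g - s g) \<le> e * indicator K g)"
proof -
  have "compact (f ` K)"
    using compact_continuous_image[OF continuous_on_subset[OF f] K(1)] by simp
  then obtain D where D: "finite D" "f ` K \<subseteq> (\<Union>x\<in>D. ball x e)"
    using e unfolding compact_eq_totally_bounded by blast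
  obtain c and n :: nat where c: "D = c ` {i. i < n}"
    using finite_imp_nat_seg_image_inj_on[OF D(1)] by blast
  \<comment> \<open>Choosing the first centre within distance \<open>e\<close> makes the choice
    measurable: it is a least index over countably many open conditions on \<open>g\<close>. This is
    why the finite set \<open>D\<close> was enumerated by natural numbers.\<close>
  define k where "k g = (LEAST i. dist (c i) (f g) < e)" for g
  define s where "s g = (if g \<in> K then c (k g) else 0)" for g
  have k: "k g < n \<and> dist (c (k g)) (f g) < e" if "g \<in> K" for g
  proof -
    have "f g \<in> (\<Union>x\<in>D. ball x e)"
      using that D(2) by blast
    then obtain i where i: "i < n" "dist (c i) (f g) < e"
      using c by auto
    have "dist (c (k g)) (f g) < e" "k g \<le> i"
      unfolding k_def using i(2) by (rule LeastI, rule Least_le)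
    then show ?thesis
      using i(1) by simp
  qed
  have Km: "K \<in> sets M"
    using K(1) M by (auto intro: borel_closed compact_imp_closed)
  have sp: "space M = UNIV"
    using sets_eq_imp_space_eq[OF M] by (metis space_borel)
  have pm: "{g. dist (c i) (f g) < e} \<in> sets M" for i
    unfolding M
    by (rule borel_open, rule open_Collect_less) (rule continuous_on_dist continuous_on_const f)+
  have [measurable]: "Measurable.pred M (\<lambda>g. dist (c i) (f g) < e)" for i
    using pm[of i] by (simp add: pred_def sp)
  have km: "k \<in> measurable M (count_space UNIV)"
    unfolding k_def by measurable
  have "simple_function M s"
    unfolding simple_function_def
  proof safe
    have "s ` space M \<subseteq> insert 0 D"
      using k c by (auto simp: s_def)
    then show "finite (s ` space M)"
      using D(1) by (meson finite.insertI finite_subset)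
    fix g
    have "s -` {s g} \<inter> space M
        = (K \<inter> (k -` {i. c i = s g} \<inter> space M)) \<union> (if s g = 0 then space M - K else {})"
      by (auto simp: s_def sp split: if_splits)
    also have "\<dots> \<in> sets M"
      using Km measurable_sets[OF km, of "{i. c i = s g}"] by auto
    finally show "s -` {s g} \<inter> space M \<in> sets M" .
  qed
  moreover have "emeasure M {g\<in>space M. s g \<noteq> 0} \<le> emeasure M K"
    using Km by (intro emeasure_mono) (auto simp: s_def)
  ultimately have "Bochner_Integration.simple_bochner_integrable M s"
    using K(2) by (intro simple_bochner_integrable.intros) auto
  moreover have "norm (f g - s g) \<le> e * indicator K g" for g
    using k[of g] out[of g] by (auto simp: s_def dist_norm norm_minus_commute indicator_def)
  ultimately show ?thesis
    by blast
qed

text \<open>A uniform error of \<open>1 / Suc i\<close> on \<open>K\<close> becomes an error of at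
  most \<open>r i\<close>, that is \<open>measure M K / Suc i\<close>, in mean. Hence the simple
  integrals form a Cauchy sequence, and completeness of the target provides the value.\<close>

lemma has_bochner_integral_in_continuous:
  fixes f :: "'a::t2_space \<Rightarrow> 'b::banach"
  assumes M: "sets M = sets borel" and f: "continuous_on UNIV f"
    and K: "compact K" "emeasure M K < \<infinity>" and out: "\<And>g. g \<notin> K \<Longrightarrow> f g = 0"
  shows "\<exists>x. has_bochner_integral_in M f x"
proof -
  have "\<forall>i. \<exists>s. Bochner_Integration.simple_bochner_integrable M s \<and>
      (\<forall>g. norm (f g - s g) \<le> 1 / real (Suc i) * indicator K g)"
    by (intro allI continuous_simple_approximation assms) auto
  then obtain s where s: "\<And>i. Bochner_Integration.simple_bochner_integrable M (s i)"
      and le: "\<And>i g. norm (f g - s i g) \<le> 1 / real (Suc i) * indicator K g"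
    by metis
  have fm: "f \<in> borel_measurable M"
    using borel_measurable_continuous_onI[OF f] M measurable_cong_sets by blast
  have Km: "K \<in> sets M"
    using K(1) M by (auto intro: borel_closed compact_imp_closed)
  define I where "I i = (\<integral>\<^sup>+g. norm (f g - s i g) \<partial>M)" for i
  define r where "r i = 1 / real (Suc i) * measure M K" for i
  define S where "S i = Bochner_Integration.simple_bochner_integral M (s i)" for i
  have r0: "0 \<le> r i" for i
    by (simp add: r_def)
  have I: "I i \<le> ennreal (r i)" for i
  proof -
    have "I i \<le> (\<integral>\<^sup>+g. ennreal (1 / real (Suc i)) * indicator K g \<partial>M)"
      unfolding I_def
    proof (intro nn_integral_mono)
      show "ennreal (norm (f g - s i g)) \<le> ennreal (1 / real (Suc i)) * indicator K g" for g
        using ennreal_leI[OF le[of g i]] by (cases "g \<in> K") auto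
    qed
    also have "\<dots> = ennreal (1 / real (Suc i)) * emeasure M K"
      using Km by (rule nn_integral_cmult_indicator)
    also have "\<dots> = ennreal (r i)"
      unfolding r_def using K(2) by (subst ennreal_mult) (auto simp: emeasure_eq_ennreal_measure)
    finally show ?thesis .
  qed
  have rlim: "r \<longlonglongrightarrow> 0"
    unfolding r_def using tendsto_mult_left_zero[OF LIMSEQ_inverse_real_of_nat]
    by (simp add: divide_inverse)
  have "(\<lambda>i. ennreal (r i)) \<longlonglongrightarrow> 0"
    using tendsto_ennrealI[OF rlim] by simp
  then have lim: "I \<longlonglongrightarrow> 0"
    by (rule tendsto_sandwich[OF _ always_eventually[OF allI[OF I]] tendsto_const, rotated]) simp
  have diff: "norm (S i - S j) \<le> r i + r j" for i j
  proof -
    have "ennreal (norm (S i - S j)) \<le> I i + I j"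
      unfolding I_def S_def by (intro simple_bochner_integral_diff_le fm s)
    also have "\<dots> \<le> ennreal (r i) + ennreal (r j)"
      by (intro add_mono I)
    also have "\<dots> = ennreal (r i + r j)"
      using r0 by (simp only: ennreal_plus)
    finally show ?thesis
      by (subst (asm) ennreal_le_iff) (simp add: r0)
  qed
  have "Cauchy S"
  proof (rule metric_CauchyI)
    fix e :: real assume "0 < e"
    then have "\<forall>\<^sub>F i in sequentially. r i < e / 2"
      by (intro order_tendstoD(2)[OF rlim]) simp
    then obtain N where N: "\<And>i. i \<ge> N \<Longrightarrow> r i < e / 2"
      by (auto simp: eventually_sequentially)
    have "dist (S m) (S n) < e" if "m \<ge> N" "n \<ge> N" for m n
      using diff[of m n] N[OF that(1)] N[OF that(2)] by (simp add: dist_norm)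
    then show "\<exists>N. \<forall>m\<ge>N. \<forall>n\<ge>N. dist (S m) (S n) < e"
      by blast
  qed
  then obtain x where "S \<longlonglongrightarrow> x"
    by (auto simp: Cauchy_convergent_iff convergent_def)
  then show ?thesis
    using fm s lim unfolding I_def S_def has_bochner_integral_in_def by blast
qed

section \<open>The operators of a representation\<close>

lemma bounded_bilinear_scaleC: "bounded_bilinear (scaleC :: complex \<Rightarrow> 'a::complex_banach \<Rightarrow> 'a)"
proof
  fix c :: complex and x :: 'a and r :: real
  show "(r *\<^sub>R c) *\<^sub>C x = r *\<^sub>R (c *\<^sub>C x)"
    by (simp add: scaleR_conv_of_real flip: scaleC_scaleC scaleC_of_real)
  show "c *\<^sub>C (r *\<^sub>R x) = r *\<^sub>R (c *\<^sub>C x)"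
    by (simp add: scaleC_scaleC mult.commute flip: scaleC_of_real)
  show "\<exists>K. \<forall>(a::complex) (b::'a). norm (a *\<^sub>C b) \<le> norm a * norm b * K"
    by (intro exI[of _ 1]) (simp add: norm_scaleC)
qed (simp_all add: scaleC_add_left scaleC_add_right)

lemma bounded_clinear_mapI:
  assumes cl: "clinear_map T" and T: "\<And>v. norm (T v) \<le> C * norm v"
  shows "bounded_clinear_map T"
proof -
  have "bounded_linear T"
  proof (rule bounded_linear_intro)
    show "T (r *\<^sub>R v) = r *\<^sub>R T v" for r v
      using cl by (simp add: clinear_map_def flip: scaleC_of_real)
    show "norm (T v) \<le> norm v * C" for v
      using T[of v] by (simp add: mult.commute)
  qed (use cl in \<open>simp add: clinear_map_def\<close>)
  then show ?thesis
    using cl by (simp add: bounded_clinear_map_def)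
qed

lemma CcE:
  assumes "f \<in> Cc"
  obtains K where "continuous_on UNIV f" "compact K" "\<And>g. g \<notin> K \<Longrightarrow> f g = 0"
  using assms closure_subset[of "{g. f g \<noteq> 0}"] unfolding Cc_def by blast

lemma Cc_diff:
  fixes f h :: "'g::t2_space \<Rightarrow> complex"
  assumes "f \<in> Cc" "h \<in> Cc"
  shows "(\<lambda>g. f g - h g) \<in> Cc"
proof -
  obtain K where f: "continuous_on UNIV f" and K: "compact K" "\<And>g. g \<notin> K \<Longrightarrow> f g = 0"
    using CcE[OF assms(1)] by blast
  obtain L where h: "continuous_on UNIV h" and L: "compact L" "\<And>g. g \<notin> L \<Longrightarrow> h g = 0"
    using CcE[OF assms(2)] by blast
  have KL: "compact (K \<union> L)"
    using K(1) L(1) by (rule compact_Un)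
  \<comment> \<open>In a Hausdorff group the compact set \<open>K \<union> L\<close> is closed, so
    it contains the closure of everything inside it.\<close>
  have "closure {g. f g - h g \<noteq> 0} \<subseteq> K \<union> L"
  proof (intro closure_minimal compact_imp_closed[OF KL] subsetI)
    show "g \<in> K \<union> L" if "g \<in> {g. f g - h g \<noteq> 0}" for g
      using that K(2)[of g] L(2)[of g] by (cases "g \<in> K"; cases "g \<in> L") simp_all
  qed
  then have "compact (closure {g. f g - h g \<noteq> 0})"
    using compact_Int_closed[OF KL closed_closure] by (metis inf.absorb_iff2)
  then show ?thesis
    using f h unfolding Cc_def by (auto intro: continuous_on_diff)
qed

lemma representation_bounded_linear: "representation \<pi> \<Longrightarrow> bounded_linear (\<pi> g)"
  unfolding representation_def bounded_clinear_map_def by blast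

text \<open>Strong continuity of \<pi> and compact support of f make the integrand continuous with
  compact support, so the definite description behind \<open>rep_op\<close> denotes an actual
  integral. All later facts about \<open>rep_op\<close> rest on this.\<close>

lemma has_bochner_integral_rep_op:
  fixes \<pi> :: "'g::{topological_group_add, t2_space} \<Rightarrow> 'b::complex_banach \<Rightarrow> 'b"
  assumes haar: "left_haar_measure \<mu>" and rep: "representation \<pi>" and f: "f \<in> Cc"
  shows "has_bochner_integral_in \<mu> (\<lambda>g. f g *\<^sub>C \<pi> g v) (rep_op \<mu> \<pi> f v)"
proof -
  obtain K where "continuous_on UNIV f" and K: "compact K" "\<And>g. g \<notin> K \<Longrightarrow> f g = 0"
    using CcE[OF f] by blast
  moreover have "continuous_on UNIV (\<lambda>g. \<pi> g v)"
    using rep by (simp add: representation_def)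
  ultimately have "continuous_on UNIV (\<lambda>g. f g *\<^sub>C \<pi> g v)"
    by (intro bounded_bilinear.continuous_on[OF bounded_bilinear_scaleC])
  then have "\<exists>x. has_bochner_integral_in \<mu> (\<lambda>g. f g *\<^sub>C \<pi> g v) x"
    using haar K bounded_bilinear.zero_left[OF bounded_bilinear_scaleC]
    by (intro has_bochner_integral_in_continuous[of _ _ K]) (auto simp: left_haar_measure_def)
  then show ?thesis
    unfolding rep_op_def using bochner_integral_in_eq by metis
qed

lemma rep_op_eqI:
  "has_bochner_integral_in \<mu> (\<lambda>g. f g *\<^sub>C \<pi> g v) x \<Longrightarrow> rep_op \<mu> \<pi> f v = x"
  by (simp add: rep_op_def bochner_integral_in_eq)

lemma rep_op_diff:
  fixes \<pi> :: "'g::{topological_group_add, t2_space} \<Rightarrow> 'b::complex_banach \<Rightarrow> 'b"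
  assumes "left_haar_measure \<mu>" "representation \<pi>" "f \<in> Cc" "h \<in> Cc"
  shows "rep_op \<mu> \<pi> (\<lambda>g. f g - h g) v = rep_op \<mu> \<pi> f v - rep_op \<mu> \<pi> h v"
proof -
  note int = has_bochner_integral_rep_op[OF assms(1,2)]
  have eq: "(\<lambda>g. f g *\<^sub>C \<pi> g v + - (h g *\<^sub>C \<pi> g v)) = (\<lambda>g. (f g - h g) *\<^sub>C \<pi> g v)"
    by (simp add: bounded_bilinear.diff_left[OF bounded_bilinear_scaleC])
  have "has_bochner_integral_in \<mu> (\<lambda>g. f g *\<^sub>C \<pi> g v + - (h g *\<^sub>C \<pi> g v))
      (rep_op \<mu> \<pi> f v + - rep_op \<mu> \<pi> h v)"
  proof (rule has_bochner_integral_in_add)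
    \<comment> \<open>The sum equals the integrand of \<open>f - h\<close>, which again lies in
      \<open>Cc\<close>; its measurability comes from there.\<close>
    show "(\<lambda>g. f g *\<^sub>C \<pi> g v + - (h g *\<^sub>C \<pi> g v)) \<in> borel_measurable \<mu>"
      using int[OF Cc_diff[OF assms(3,4)], of v] unfolding eq has_bochner_integral_in_def by blast
  qed (use assms int in \<open>auto intro: has_bochner_integral_in_bounded_linear
      [OF bounded_linear_minus[OF bounded_linear_ident]]\<close>)
  then show ?thesis
    unfolding eq by (simp add: rep_op_eqI)
qed

lemma clinear_map_rep_op:
  fixes \<pi> :: "'g::{topological_group_add, t2_space} \<Rightarrow> 'b::complex_banach \<Rightarrow> 'b"
  assumes haar: "left_haar_measure \<mu>" and rep: "representation \<pi>" and f: "f \<in> Cc"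
  shows "clinear_map (rep_op \<mu> \<pi> f)"
proof -
  note int = has_bochner_integral_rep_op[OF assms]
  have cl: "\<pi> g (v + w) = \<pi> g v + \<pi> g w" "\<pi> g (c *\<^sub>C v) = c *\<^sub>C \<pi> g v" for g c v w
    using rep by (auto simp: representation_def bounded_clinear_map_def clinear_map_def)
  have "rep_op \<mu> \<pi> f (v + w) = rep_op \<mu> \<pi> f v + rep_op \<mu> \<pi> f w" for v w
  proof (rule rep_op_eqI)
    have "(\<lambda>g. f g *\<^sub>C \<pi> g v + f g *\<^sub>C \<pi> g w) \<in> borel_measurable \<mu>"
      using int[of "v + w"] unfolding cl scaleC_add_right has_bochner_integral_in_def by blast
    then show "has_bochner_integral_in \<mu> (\<lambda>g. f g *\<^sub>C \<pi> g (v + w)) (rep_op \<mu> \<pi> f v + rep_op \<mu> \<pi> f w)"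
      unfolding cl scaleC_add_right by (intro has_bochner_integral_in_add int)
  qed
  moreover have "rep_op \<mu> \<pi> f (c *\<^sub>C v) = c *\<^sub>C rep_op \<mu> \<pi> f v" for c v
  proof (rule rep_op_eqI)
    have "(\<lambda>g. c *\<^sub>C (f g *\<^sub>C \<pi> g v)) = (\<lambda>g. f g *\<^sub>C \<pi> g (c *\<^sub>C v))"
      by (simp add: cl scaleC_scaleC mult.commute)
    then show "has_bochner_integral_in \<mu> (\<lambda>g. f g *\<^sub>C \<pi> g (c *\<^sub>C v)) (c *\<^sub>C rep_op \<mu> \<pi> f v)"
      using has_bochner_integral_in_bounded_linear
        [OF bounded_bilinear.bounded_linear_right[OF bounded_bilinear_scaleC] int[of v], of c] by simp
  qed
  ultimately show ?thesis
    by (simp add: clinear_map_def)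
qed

section \<open>Bounds uniform over a family of representations\<close>

text \<open>The constant is the maximum of \<open>cmod (f g) * exp (l g)\<close> over a compact set
  \<open>K\<close> carrying \<open>f\<close>, times the measure of \<open>K\<close>. It is chosen
  before \<pi> and v, and this uniformity is what makes the supremum in \<open>family_norm\<close> a
  supremum of a bounded set.\<close>

lemma norm_rep_op_le:
  fixes f :: "'g::{topological_group_add, t2_space} \<Rightarrow> complex"
  assumes haar: "left_haar_measure \<mu>" and l: "continuous_on UNIV l" and f: "f \<in> Cc"
  shows "\<exists>C\<ge>0. \<forall>\<pi>\<in>(reps_bounded_by l :: ('g \<Rightarrow> 'b::complex_banach \<Rightarrow> 'b) set).
    \<forall>v. norm (rep_op \<mu> \<pi> f v) \<le> C * norm v"
proof -
  obtain K where fc: "continuous_on UNIV f" and K: "compact K" and out: "\<And>g. g \<notin> K \<Longrightarrow> f g = 0"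
    using CcE[OF f] by blast
  have "continuous_on K (\<lambda>g. cmod (f g) * exp (l g))"
    using continuous_on_mult[OF continuous_on_norm[OF fc] continuous_on_exp[OF l]]
    by (rule continuous_on_subset) simp
  then have "compact ((\<lambda>g. cmod (f g) * exp (l g)) ` K)"
    using K by (rule compact_continuous_image)
  from compact_imp_bounded[OF this]
  obtain B where "0 < B" "\<And>g. g \<in> K \<Longrightarrow> norm (cmod (f g) * exp (l g)) \<le> B"
    unfolding bounded_pos by blast
  then have B: "\<And>g. g \<in> K \<Longrightarrow> cmod (f g) * exp (l g) \<le> B" "0 \<le> B"
    by simp_all
  have Km: "K \<in> sets \<mu>" "emeasure \<mu> K < \<infinity>"
    using haar K by (auto simp: left_haar_measure_def intro: borel_closed compact_imp_closed)
  have "norm (rep_op \<mu> \<pi> f v) \<le> B * measure \<mu> K * norm v"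
    if \<pi>: "\<pi> \<in> reps_bounded_by l" for \<pi> :: "'g \<Rightarrow> 'b \<Rightarrow> 'b" and v
  proof -
    have rep: "representation \<pi>" and on: "onorm (\<pi> g) \<le> exp (l g)" for g
      using \<pi> by (auto simp: reps_bounded_by_def)
    have nle: "norm (f g *\<^sub>C \<pi> g v) \<le> B * norm v * indicator K g" for g
    proof (cases "g \<in> K")
      case True
      have "norm (\<pi> g v) \<le> exp (l g) * norm v"
        using onorm[OF representation_bounded_linear[OF rep], of g v] on[of g]
        by (meson mult_right_mono norm_ge_zero order_trans)
      then have "norm (f g *\<^sub>C \<pi> g v) \<le> cmod (f g) * (exp (l g) * norm v)"
        by (simp add: norm_scaleC mult_left_mono)
      also have "\<dots> \<le> B * norm v"
        using mult_right_mono[OF B(1)[OF True] norm_ge_zero[of v]] by (simp add: mult.assoc)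
      finally show ?thesis
        using True by simp
    qed (simp add: out norm_scaleC)
    have "ennreal (norm (rep_op \<mu> \<pi> f v)) \<le> (\<integral>\<^sup>+g. norm (f g *\<^sub>C \<pi> g v) \<partial>\<mu>)"
      by (intro has_bochner_integral_in_norm_le has_bochner_integral_rep_op haar rep f)
    also have "\<dots> \<le> (\<integral>\<^sup>+g. ennreal (B * norm v) * indicator K g \<partial>\<mu>)"
    proof (intro nn_integral_mono)
      show "ennreal (norm (f g *\<^sub>C \<pi> g v)) \<le> ennreal (B * norm v) * indicator K g" for g
        using ennreal_leI[OF nle[of g]] by (cases "g \<in> K") auto
    qed
    also have "\<dots> = ennreal (B * norm v) * emeasure \<mu> K"
      using Km(1) by (rule nn_integral_cmult_indicator)
    also have "\<dots> = ennreal (B * norm v * measure \<mu> K)"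
      using Km(2) B(2) by (subst ennreal_mult) (auto simp: emeasure_eq_ennreal_measure)
    finally show ?thesis
      using B(2) by (subst (asm) ennreal_le_iff) (simp_all add: algebra_simps)
  qed
  then show ?thesis
    using B(2) by (intro exI[of _ "B * measure \<mu> K"]) auto
qed

lemma bounded_clinear_map_rep_op:
  fixes \<pi> :: "'g::{topological_group_add, t2_space} \<Rightarrow> 'b::complex_banach \<Rightarrow> 'b"
  assumes haar: "left_haar_measure \<mu>" and l: "continuous_on UNIV l"
    and \<pi>: "\<pi> \<in> reps_bounded_by l" and f: "f \<in> Cc"
  shows "bounded_clinear_map (rep_op \<mu> \<pi> f)"
proof -
  have cl: "clinear_map (rep_op \<mu> \<pi> f)"
    using \<pi> by (intro clinear_map_rep_op haar f) (simp add: reps_bounded_by_def)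
  obtain C where "\<And>v. norm (rep_op \<mu> \<pi> f v) \<le> C * norm v"
    using norm_rep_op_le[OF haar l f] \<pi> by blast
  with cl show ?thesis
    by (rule bounded_clinear_mapI)
qed

lemma onorm_rep_op_le_family_norm:
  fixes \<pi> :: "'g::{topological_group_add, t2_space} \<Rightarrow> 'b::complex_banach \<Rightarrow> 'b"
  assumes haar: "left_haar_measure \<mu>" and l: "continuous_on UNIV l"
    and \<pi>: "\<pi> \<in> reps_bounded_by l" and f: "f \<in> Cc"
  shows "onorm (rep_op \<mu> \<pi> f) \<le> family_norm \<mu> (reps_bounded_by l :: ('g \<Rightarrow> 'b \<Rightarrow> 'b) set) f"
proof -
  obtain C where C: "0 \<le> C" "\<And>\<pi> :: 'g \<Rightarrow> 'b \<Rightarrow> 'b. \<And>v. \<pi> \<in> reps_bounded_by l \<Longrightarrow>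
      norm (rep_op \<mu> \<pi> f v) \<le> C * norm v"
    using norm_rep_op_le[OF haar l f, where 'b = 'b] by blast
  then have "onorm (rep_op \<mu> \<pi> f) \<le> C" if "\<pi> \<in> reps_bounded_by l" for \<pi> :: "'g \<Rightarrow> 'b \<Rightarrow> 'b"
    using that by (intro onorm_bound) auto
  then have "bdd_above ((\<lambda>\<pi>. onorm (rep_op \<mu> \<pi> f)) ` (reps_bounded_by l :: ('g \<Rightarrow> 'b \<Rightarrow> 'b) set))"
    by (intro bdd_aboveI2)
  then show ?thesis
    unfolding family_norm_def by (intro cSUP_upper \<pi>)
qed

lemma onorm_rep_op_diff_le_family_dist:
  fixes \<pi> :: "'g::{topological_group_add, t2_space} \<Rightarrow> 'b::complex_banach \<Rightarrow> 'b"
  assumes haar: "left_haar_measure \<mu>" and l: "continuous_on UNIV l"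
    and \<pi>: "\<pi> \<in> reps_bounded_by l" and f: "f \<in> Cc" and h: "h \<in> Cc"
  shows "onorm (\<lambda>v. rep_op \<mu> \<pi> f v - rep_op \<mu> \<pi> h v)
    \<le> family_dist \<mu> (reps_bounded_by l :: ('g \<Rightarrow> 'b \<Rightarrow> 'b) set) f h"
proof -
  have "(\<lambda>v. rep_op \<mu> \<pi> f v - rep_op \<mu> \<pi> h v) = rep_op \<mu> \<pi> (\<lambda>g. f g - h g)"
    using \<pi> by (simp add: fun_eq_iff rep_op_diff[OF haar _ f h] reps_bounded_by_def)
  then show ?thesis
    unfolding family_dist_def using onorm_rep_op_le_family_norm[OF haar l \<pi> Cc_diff[OF f h]] by simp
qed

section \<open>Convergence in the completion\<close>

text \<open>The axioms are relative to a carrier because \<open>family_dist\<close> is controlled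
  only on \<open>Cc\<close>, where the integrals exist. Distinct points may have distance 0.\<close>

locale pseudometric_on =
  fixes V :: "'v set" and d :: "'v \<Rightarrow> 'v \<Rightarrow> real"
  assumes nonneg: "x \<in> V \<Longrightarrow> y \<in> V \<Longrightarrow> 0 \<le> d x y"
    and zero: "x \<in> V \<Longrightarrow> d x x = 0"
    and commute: "x \<in> V \<Longrightarrow> y \<in> V \<Longrightarrow> d x y = d y x"
    and triangle: "x \<in> V \<Longrightarrow> y \<in> V \<Longrightarrow> z \<in> V \<Longrightarrow> d x z \<le> d x y + d y z"
begin

lemma completionE:
  assumes "p \<in> completion V d"
  obtains u where "u \<in> p" "u \<in> cauchy_seqs V d" "p = cauchy_rel V d `` {u}"
proof -
  obtain u where u: "u \<in> cauchy_seqs V d" "p = cauchy_rel V d `` {u}"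
    using assms by (auto simp: completion_def quotient_def)
  then have "u \<in> p"
    by (simp add: cauchy_rel_def cauchy_seqs_def zero)
  with u that show thesis by blast
qed

lemma completion_in_cauchy_seqs: "p \<in> completion V d \<Longrightarrow> u \<in> p \<Longrightarrow> u \<in> cauchy_seqs V d"
  by (auto simp: completion_def quotient_def cauchy_rel_def)

text \<open>Both sequences are compared with the representative \<open>a\<close> that generates the
  class \<open>p\<close>.\<close>

lemma completion_tendsto_0:
  assumes p: "p \<in> completion V d" and u: "u \<in> p" and w: "w \<in> p"
  shows "(\<lambda>n. d (u n) (w n)) \<longlonglongrightarrow> 0"
proof -
  obtain a where a: "a \<in> cauchy_seqs V d" "p = cauchy_rel V d `` {a}"
    using completionE[OF p] by metis
  then have V: "a n \<in> V" "u n \<in> V" "w n \<in> V" for n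
    using completion_in_cauchy_seqs[OF p u] completion_in_cauchy_seqs[OF p w]
    by (simp_all add: cauchy_seqs_def)
  have "(\<lambda>n. d (a n) (u n)) \<longlonglongrightarrow> 0" "(\<lambda>n. d (a n) (w n)) \<longlonglongrightarrow> 0"
    using a u w by (auto simp: cauchy_rel_def)
  then have lim: "(\<lambda>n. d (a n) (u n) + d (a n) (w n)) \<longlonglongrightarrow> 0"
    using tendsto_add by fastforce
  have "norm (d (u n) (w n)) \<le> d (a n) (u n) + d (a n) (w n)" for n
    using triangle[OF V(2,1,3)] commute[OF V(2,1)] nonneg[OF V(2,3)] by simp
  then show ?thesis
    by (intro Lim_null_comparison[OF _ lim]) simp
qed

lemma dist_limit_exists:
  assumes x: "x \<in> V" and u: "u \<in> cauchy_seqs V d"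
  shows "convergent (\<lambda>k. d x (u k))"
proof -
  have V: "u n \<in> V" for n
    using u by (simp add: cauchy_seqs_def)
  have le: "\<bar>d x (u m) - d x (u n)\<bar> \<le> d (u m) (u n)" for m n
    using triangle[OF x V V, of m n] triangle[OF x V V, of n m] commute[OF V V, of m n] by simp
  have "Cauchy (\<lambda>k. d x (u k))"
  proof (rule metric_CauchyI)
    fix e :: real assume "0 < e"
    then obtain N where "\<And>m n. m \<ge> N \<Longrightarrow> n \<ge> N \<Longrightarrow> d (u m) (u n) < e"
      using u unfolding cauchy_seqs_def by blast
    then show "\<exists>N. \<forall>m\<ge>N. \<forall>n\<ge>N. dist (d x (u m)) (d x (u n)) < e"
      unfolding dist_real_def using le le_less_trans by blast
  qed
  then show ?thesis
    by (rule Cauchy_convergent)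
qed

text \<open>\<open>completion_dist\<close> describes a limit common to all pairs of representatives,
  so the limit along the constant sequence \<open>x\<close> and one \<open>u\<close> has to be shown
  independent of that choice.\<close>

lemma completion_dist_embed:
  assumes x: "x \<in> V" and p: "p \<in> completion V d" and u: "u \<in> p"
  shows "(\<lambda>k. d x (u k)) \<longlonglongrightarrow> completion_dist d (completion_embed V d x) p"
proof -
  have uc: "u \<in> cauchy_seqs V d"
    using p u by (rule completion_in_cauchy_seqs)
  obtain r where r: "(\<lambda>k. d x (u k)) \<longlonglongrightarrow> r"
    using dist_limit_exists[OF x uc] by (auto simp: convergent_def)
  have emb: "(\<lambda>_. x) \<in> completion_embed V d x"
    using x by (simp add: completion_embed_def cauchy_rel_def cauchy_seqs_def zero)
  have "(\<lambda>k. d (a k) (w k)) \<longlonglongrightarrow> r" if a: "a \<in> completion_embed V d x" and w: "w \<in> p" for a w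
  proof -
    have aV: "a k \<in> V" and uV: "u k \<in> V" and wV: "w k \<in> V" for k
      using a uc completion_in_cauchy_seqs[OF p w]
      by (auto simp: completion_embed_def cauchy_rel_def cauchy_seqs_def)
    have "(\<lambda>k. d x (a k)) \<longlonglongrightarrow> 0"
      using a by (simp add: completion_embed_def cauchy_rel_def)
    then have lim: "(\<lambda>k. d x (a k) + d (u k) (w k)) \<longlonglongrightarrow> 0"
      using tendsto_add[OF _ completion_tendsto_0[OF p u w]] by fastforce
    \<comment> \<open>Replacing \<open>a k\<close> by \<open>x\<close> and \<open>w k\<close> by
      \<open>u k\<close> changes the distance by at most the two terms on the right, in either
      direction.\<close>
    have "norm (d (a k) (w k) - d x (u k)) \<le> d x (a k) + d (u k) (w k)" for k
      using triangle[OF aV[of k] x wV[of k]] triangle[OF x uV[of k] wV[of k]]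
        triangle[OF x aV[of k] uV[of k]] triangle[OF aV[of k] wV[of k] uV[of k]]
        commute[OF aV[of k] x] commute[OF uV[of k] wV[of k]]
      by (simp add: abs_le_iff)
    then have "(\<lambda>k. d (a k) (w k) - d x (u k)) \<longlonglongrightarrow> 0"
      by (intro Lim_null_comparison[OF _ lim]) simp
    from tendsto_add[OF this r] show ?thesis
      by simp
  qed
  moreover have "s = r" if "\<forall>a\<in>completion_embed V d x. \<forall>w\<in>p. (\<lambda>k. d (a k) (w k)) \<longlonglongrightarrow> s" for s
    using that emb u r LIMSEQ_unique by blast
  ultimately have "completion_dist d (completion_embed V d x) p = r"
    unfolding completion_dist_def by (intro the_equality) auto
  with r show ?thesis
    by simp
qed

end

section \<open>The family distance and the extension of a representation to the completion\<close>

text \<open>The member \<pi> witnesses that the family is nonempty, which suprema in the reals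
  require.\<close>

lemma pseudometric_on_family_dist:
  fixes \<pi> :: "'g::{topological_group_add, t2_space} \<Rightarrow> 'b::complex_banach \<Rightarrow> 'b"
  assumes haar: "left_haar_measure \<mu>" and l: "continuous_on UNIV l" and \<pi>: "\<pi> \<in> reps_bounded_by l"
  shows "pseudometric_on Cc (family_dist \<mu> (reps_bounded_by l :: ('g \<Rightarrow> 'b \<Rightarrow> 'b) set))"
proof
  let ?F = "reps_bounded_by l :: ('g \<Rightarrow> 'b \<Rightarrow> 'b) set"
  have rep: "representation \<rho>" if "\<rho> \<in> ?F" for \<rho>
    using that by (simp add: reps_bounded_by_def)
  have bl: "bounded_linear (rep_op \<mu> \<rho> f)" if "\<rho> \<in> ?F" "f \<in> Cc" for \<rho> f
    using bounded_clinear_map_rep_op[OF haar l that] by (simp add: bounded_clinear_map_def)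
  have fd: "family_dist \<mu> ?F f h = (SUP \<rho>\<in>?F. onorm (\<lambda>v. rep_op \<mu> \<rho> f v - rep_op \<mu> \<rho> h v))"
    if "f \<in> Cc" "h \<in> Cc" for f h
    unfolding family_dist_def family_norm_def
  proof (rule SUP_cong[OF refl])
    show "onorm (rep_op \<mu> \<rho> (\<lambda>g. f g - h g)) = onorm (\<lambda>v. rep_op \<mu> \<rho> f v - rep_op \<mu> \<rho> h v)"
      if "\<rho> \<in> ?F" for \<rho>
      using rep_op_diff[OF haar rep[OF that] \<open>f \<in> Cc\<close> \<open>h \<in> Cc\<close>] by presburger
  qed
  fix f h k :: "'g \<Rightarrow> complex"
  assume f: "f \<in> Cc"
  show "family_dist \<mu> ?F f f = 0"
    using \<pi> by (subst fd[OF f f]) (auto simp: onorm_zero intro!: cSUP_const)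
  assume h: "h \<in> Cc"
  show "0 \<le> family_dist \<mu> ?F f h"
    using onorm_rep_op_diff_le_family_dist[OF haar l \<pi> f h]
      onorm_pos_le[OF bounded_linear_sub[OF bl[OF \<pi> f] bl[OF \<pi> h]]] by linarith
  have "onorm (\<lambda>v. rep_op \<mu> \<rho> f v - rep_op \<mu> \<rho> h v)
      = onorm (\<lambda>v. rep_op \<mu> \<rho> h v - rep_op \<mu> \<rho> f v)" for \<rho> :: "'g \<Rightarrow> 'b \<Rightarrow> 'b"
    using onorm_neg[of "\<lambda>v. rep_op \<mu> \<rho> f v - rep_op \<mu> \<rho> h v"] by simp
  then show "family_dist \<mu> ?F f h = family_dist \<mu> ?F h f"
    by (simp add: fd[OF f h] fd[OF h f])
  assume k: "k \<in> Cc"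
  \<comment> \<open>The triangle inequality holds for the operator norm of each single \<rho>, with
    both terms bounded by the family distances; the supremum is taken last.\<close>
  show "family_dist \<mu> ?F f k \<le> family_dist \<mu> ?F f h + family_dist \<mu> ?F h k"
  proof (subst fd[OF f k], rule cSUP_least)
    show "?F \<noteq> {}"
      using \<pi> by blast
    fix \<rho> assume \<rho>: "\<rho> \<in> ?F"
    have "onorm (\<lambda>v. rep_op \<mu> \<rho> f v - rep_op \<mu> \<rho> k v)
        = onorm (\<lambda>v. (rep_op \<mu> \<rho> f v - rep_op \<mu> \<rho> h v) + (rep_op \<mu> \<rho> h v - rep_op \<mu> \<rho> k v))"
      by simp
    also have "\<dots> \<le> family_dist \<mu> ?F f h + family_dist \<mu> ?F h k"
      using bl[OF \<rho>] f h k
      by (intro onorm_triangle_le bounded_linear_sub add_mono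
        onorm_rep_op_diff_le_family_dist[OF haar l \<rho>])
    finally show "onorm (\<lambda>v. rep_op \<mu> \<rho> f v - rep_op \<mu> \<rho> k v)
        \<le> family_dist \<mu> ?F f h + family_dist \<mu> ?F h k" .
  qed
qed

text \<open>Operator norms of differences are dominated by the family distance, so a Cauchy sequence
  representing \<open>p\<close> yields a Cauchy sequence of operators. Its limit is the same for
  every representative, because two of them approach each other in the family distance.\<close>

lemma rep_ext_properties:
  fixes \<pi> :: "'g::{topological_group_add, t2_space} \<Rightarrow> 'b::complex_banach \<Rightarrow> 'b"
  assumes haar: "left_haar_measure \<mu>" and l: "continuous_on UNIV l" and \<pi>: "\<pi> \<in> reps_bounded_by l"
    and p: "p \<in> completion Cc (family_dist \<mu> (reps_bounded_by l :: ('g \<Rightarrow> 'b \<Rightarrow> 'b) set))"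
  shows "bounded_clinear_map (rep_ext \<mu> \<pi> p)"
    and "u \<in> p \<Longrightarrow> (\<lambda>n. onorm (\<lambda>v. rep_op \<mu> \<pi> (u n) v - rep_ext \<mu> \<pi> p v)) \<longlonglongrightarrow> 0"
proof -
  let ?d = "family_dist \<mu> (reps_bounded_by l :: ('g \<Rightarrow> 'b \<Rightarrow> 'b) set)"
  let ?A = "rep_op \<mu> \<pi>"
  interpret pseudometric_on Cc ?d
    by (rule pseudometric_on_family_dist[OF haar l \<pi>])
  have bcl: "bounded_clinear_map (?A f)" and bl: "bounded_linear (?A f)" if "f \<in> Cc" for f
    using bounded_clinear_map_rep_op[OF haar l \<pi> that] by (simp_all add: bounded_clinear_map_def)
  obtain a where a: "a \<in> p" "a \<in> cauchy_seqs Cc ?d"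
    using completionE[OF p] by metis
  then have aV: "a n \<in> Cc" for n
    by (simp add: cauchy_seqs_def)
  \<comment> \<open>Bounded real-linear operators form a Banach space, which supplies the limit
    \<open>S\<close>. Complex homogeneity is recovered afterwards from pointwise limits.\<close>
  define B where "B n = Blinfun (?A (a n))" for n
  have B: "blinfun_apply (B n) = ?A (a n)" for n
    unfolding B_def by (rule bounded_linear_Blinfun_apply[OF bl[OF aV]])
  have "norm (B m - B n) \<le> ?d (a m) (a n)" for m n
    using onorm_rep_op_diff_le_family_dist[OF haar l \<pi> aV aV, of m n]
    by (simp add: norm_blinfun.rep_eq minus_blinfun.rep_eq B)
  then have "Cauchy B"
    using a(2) unfolding Cauchy_def dist_norm cauchy_seqs_def mem_Collect_eq
    by (meson le_less_trans)
  then obtain S where S: "B \<longlonglongrightarrow> S"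
    by (auto simp: Cauchy_convergent_iff convergent_def)
  let ?T = "blinfun_apply S"
  have Sv: "(\<lambda>n. ?A (a n) v) \<longlonglongrightarrow> ?T v" for v
    using bounded_linear.tendsto[OF blinfun.bounded_linear_left S, of v] by (simp add: B)
  have "?T (c *\<^sub>C v) = c *\<^sub>C ?T v" for c v
  proof (rule LIMSEQ_unique[OF Sv])
    have "(\<lambda>n. c *\<^sub>C ?A (a n) v) \<longlonglongrightarrow> c *\<^sub>C ?T v"
      by (intro bounded_linear.tendsto[OF bounded_bilinear.bounded_linear_right
        [OF bounded_bilinear_scaleC]] Sv)
    then show "(\<lambda>n. ?A (a n) (c *\<^sub>C v)) \<longlonglongrightarrow> c *\<^sub>C ?T v"
      using bcl[OF aV] by (simp add: bounded_clinear_map_def clinear_map_def)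
  qed
  then have T: "bounded_clinear_map ?T"
    by (simp add: bounded_clinear_map_def clinear_map_def blinfun.add_right blinfun.bounded_linear_right)
  have lim: "(\<lambda>n. onorm (\<lambda>v. ?A (w n) v - ?T v)) \<longlonglongrightarrow> 0" if w: "w \<in> p" for w
  proof -
    have wV: "w n \<in> Cc" for n
      using completion_in_cauchy_seqs[OF p w] by (simp add: cauchy_seqs_def)
    have "(\<lambda>n. norm (B n - S)) \<longlonglongrightarrow> 0"
      using S by (simp add: LIM_zero tendsto_norm_zero)
    then have l0: "(\<lambda>n. ?d (w n) (a n) + norm (B n - S)) \<longlonglongrightarrow> 0"
      using tendsto_add[OF completion_tendsto_0[OF p w a(1)]] by fastforce
    have "norm (onorm (\<lambda>v. ?A (w n) v - ?T v)) \<le> ?d (w n) (a n) + norm (B n - S)" for n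
    proof -
      have "onorm (\<lambda>v. ?A (w n) v - ?T v)
          = onorm (\<lambda>v. (?A (w n) v - ?A (a n) v) + (?A (a n) v - ?T v))"
        by simp
      also have "\<dots> \<le> ?d (w n) (a n) + norm (B n - S)"
      proof (intro onorm_triangle_le add_mono bounded_linear_sub bl wV aV
          blinfun.bounded_linear_right onorm_rep_op_diff_le_family_dist[OF haar l \<pi>])
        show "onorm (\<lambda>v. ?A (a n) v - ?T v) \<le> norm (B n - S)"
          by (simp add: norm_blinfun.rep_eq minus_blinfun.rep_eq B)
      qed
      finally show ?thesis
        using onorm_pos_le[OF bounded_linear_sub[OF bl[OF wV] blinfun.bounded_linear_right], of n S]
        by simp
    qed
    then show ?thesis
      by (intro Lim_null_comparison[OF _ l0]) simp
  qed
  \<comment> \<open>A competitor is also the pointwise limit of the operators of the single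
    representative \<open>a\<close>, hence agrees with \<open>?T\<close> at every vector.\<close>
  have "T' = ?T" if T': "bounded_clinear_map T'"
    "\<forall>u\<in>p. (\<lambda>n. onorm (\<lambda>v. ?A (u n) v - T' v)) \<longlonglongrightarrow> 0" for T'
  proof
    fix v
    have "bounded_linear (\<lambda>v. ?A (a n) v - T' v)" for n
      using T'(1) bl[OF aV] by (intro bounded_linear_sub) (simp_all add: bounded_clinear_map_def)
    then have "norm (?A (a n) v - T' v) \<le> onorm (\<lambda>v. ?A (a n) v - T' v) * norm v" for n
      by (rule onorm)
    moreover have "(\<lambda>n. onorm (\<lambda>v. ?A (a n) v - T' v) * norm v) \<longlonglongrightarrow> 0"
      using T'(2) a(1) by (intro tendsto_mult_left_zero) blast
    ultimately have "(\<lambda>n. ?A (a n) v - T' v) \<longlonglongrightarrow> 0"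
      by (intro Lim_null_comparison[of "\<lambda>n. ?A (a n) v - T' v"]) simp_all
    then have "(\<lambda>n. ?A (a n) v) \<longlonglongrightarrow> T' v"
      by (rule LIM_zero_cancel)
    then show "T' v = ?T v"
      using Sv[of v] by (rule LIMSEQ_unique)
  qed
  then have "rep_ext \<mu> \<pi> p = ?T"
    unfolding rep_ext_def
    by (intro the_equality) (simp_all add: T lim)
  then show "bounded_clinear_map (rep_ext \<mu> \<pi> p)"
    and "u \<in> p \<Longrightarrow> (\<lambda>n. onorm (\<lambda>v. ?A (u n) v - rep_ext \<mu> \<pi> p v)) \<longlonglongrightarrow> 0"
    using T lim by simp_all
qed

text \<open>The sequence \<open>f\<close> need not itself be the chosen representative of
  \<open>p\<close>. Passing through \<open>u k\<close> and letting k tend to infinity bounds the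
  operator distance from \<pi>(f n) to \<pi>(p) by the distance from \<open>f n\<close> to
  \<open>p\<close> in the completion.\<close>

lemma rep_op_tendsto_rep_ext:
  fixes \<pi> :: "'g::{topological_group_add, t2_space} \<Rightarrow> 'b::complex_banach \<Rightarrow> 'b"
  assumes haar: "left_haar_measure \<mu>" and l: "continuous_on UNIV l" and \<pi>: "\<pi> \<in> reps_bounded_by l"
    and f: "\<And>n. f n \<in> Cc"
    and conv: "converges_in_completion Cc
      (family_dist \<mu> (reps_bounded_by l :: ('g \<Rightarrow> 'b \<Rightarrow> 'b) set)) f p"
  shows "(\<lambda>n. rep_op \<mu> \<pi> (f n) v) \<longlonglongrightarrow> rep_ext \<mu> \<pi> p v"
proof -
  let ?d = "family_dist \<mu> (reps_bounded_by l :: ('g \<Rightarrow> 'b \<Rightarrow> 'b) set)"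
  let ?A = "rep_op \<mu> \<pi>" and ?T = "rep_ext \<mu> \<pi> p"
  interpret pseudometric_on Cc ?d
    by (rule pseudometric_on_family_dist[OF haar l \<pi>])
  have p: "p \<in> completion Cc ?d"
    and D: "(\<lambda>n. completion_dist ?d (completion_embed Cc ?d (f n)) p) \<longlonglongrightarrow> 0"
    using conv by (simp_all add: converges_in_completion_def)
  note ext = rep_ext_properties[OF haar l \<pi> p]
  have bl: "bounded_linear (?A h)" if "h \<in> Cc" for h
    using bounded_clinear_map_rep_op[OF haar l \<pi> that] by (simp add: bounded_clinear_map_def)
  have T: "bounded_linear ?T"
    using ext(1) by (simp add: bounded_clinear_map_def)
  obtain u where u: "u \<in> p" "u \<in> cauchy_seqs Cc ?d"
    using completionE[OF p] by metis
  then have uV: "u n \<in> Cc" for n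
    by (simp add: cauchy_seqs_def)
  have le: "onorm (\<lambda>v. ?A (f n) v - ?T v) \<le> completion_dist ?d (completion_embed Cc ?d (f n)) p" for n
  proof (rule LIMSEQ_le_const)
    show "(\<lambda>k. ?d (f n) (u k) + onorm (\<lambda>v. ?A (u k) v - ?T v))
        \<longlonglongrightarrow> completion_dist ?d (completion_embed Cc ?d (f n)) p"
      using tendsto_add[OF completion_dist_embed[OF f p u(1)] ext(2)[OF u(1)]] by simp
    have "onorm (\<lambda>v. ?A (f n) v - ?T v) \<le> ?d (f n) (u k) + onorm (\<lambda>v. ?A (u k) v - ?T v)" for k
    proof -
      have "onorm (\<lambda>v. ?A (f n) v - ?T v)
          = onorm (\<lambda>v. (?A (f n) v - ?A (u k) v) + (?A (u k) v - ?T v))"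
        by simp
      also have "\<dots> \<le> ?d (f n) (u k) + onorm (\<lambda>v. ?A (u k) v - ?T v)"
        by (intro onorm_triangle_le add_mono bounded_linear_sub bl f uV T order_refl
          onorm_rep_op_diff_le_family_dist[OF haar l \<pi>])
      finally show ?thesis .
    qed
    then show "\<exists>N. \<forall>k\<ge>N. onorm (\<lambda>v. ?A (f n) v - ?T v)
        \<le> ?d (f n) (u k) + onorm (\<lambda>v. ?A (u k) v - ?T v)"
      by blast
  qed
  have "norm (?A (f n) v - ?T v)
      \<le> completion_dist ?d (completion_embed Cc ?d (f n)) p * norm v" for n
    using onorm[OF bounded_linear_sub[OF bl[OF f] T], of n v] mult_right_mono[OF le norm_ge_zero]
    by (rule order_trans)
  then have "(\<lambda>n. ?A (f n) v - ?T v) \<longlonglongrightarrow> 0"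
    by (intro Lim_null_comparison[OF _ tendsto_mult_left_zero[OF D]] always_eventually allI)
  then show ?thesis
    by (rule LIM_zero_cancel)
qed

section \<open>Linearization of an affine isometric action\<close>

text \<open>An action only asserts that some linear part and some translation exist. Evaluation at 0
  identifies the translation as \<open>\<alpha> g 0\<close>, so both become explicit.\<close>

definition affine_linear_part :: "('g \<Rightarrow> 'x::complex_banach \<Rightarrow> 'x) \<Rightarrow> 'g \<Rightarrow> 'x \<Rightarrow> 'x"
  where "affine_linear_part \<alpha> g v = \<alpha> g v - \<alpha> g 0"

text \<open>A lower triangular block matrix with diagonal 1 and the linear part. On the slice of
  vectors \<open>(1, v)\<close> it is the action \<alpha> conjugated by the dilation
  \<open>v \<mapsto> s v\<close>, so an invariant \<open>(1, w)\<close> corresponds to a fixed point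
  \<open>w / s\<close>.\<close>

definition affine_rep ::
    "real \<Rightarrow> ('g \<Rightarrow> 'x::complex_banach \<Rightarrow> 'x) \<Rightarrow> 'g \<Rightarrow> complex \<times> 'x \<Rightarrow> complex \<times> 'x"
  where "affine_rep s \<alpha> g x =
    (fst x, affine_linear_part \<alpha> g (snd x) + (of_real s * fst x) *\<^sub>C \<alpha> g 0)"

lemma continuous_on_affine_isometric_action:
  assumes "affine_isometric_action \<alpha>"
  shows "continuous_on UNIV (\<lambda>g. \<alpha> g v)"
proof -
  have "continuous_on UNIV (\<lambda>(g, v). \<alpha> g v)"
    using assms by (simp add: affine_isometric_action_def)
  from continuous_on_compose2[OF this, of UNIV "\<lambda>g. (g, v)"] show ?thesis
    by (simp add: continuous_on_Pair)
qed

text \<open>The function measures how far g moves the origin. Since \<alpha>(g) is an isometry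
  carrying the pair \<open>\<alpha> (- g) 0\<close>, \<open>0\<close> to \<open>0\<close>,
  \<open>\<alpha> g 0\<close>, it is symmetric; subadditivity follows by moving the origin in two
  stages.\<close>

lemma length_on_displacement:
  assumes act: "affine_isometric_action \<alpha>"
  shows "length_on (\<lambda>g. norm (\<alpha> g 0))"
proof -
  have add: "\<alpha> (g + h) v = \<alpha> g (\<alpha> h v)" and zero: "\<alpha> 0 v = v"
    and iso: "norm (\<alpha> g v - \<alpha> g w) = norm (v - w)" for g h v w
    using act by (simp_all add: affine_isometric_action_def flip: dist_norm)
  have "norm (\<alpha> (- g) 0) = norm (\<alpha> g 0)" for g
    using iso[of g "\<alpha> (- g) 0" 0] by (simp add: zero flip: add)
  moreover have "norm (\<alpha> (g + h) 0) \<le> norm (\<alpha> g 0) + norm (\<alpha> h 0)" for g h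
    using norm_triangle_ineq2[of "\<alpha> g (\<alpha> h 0)" "\<alpha> g 0"] iso[of g "\<alpha> h 0" 0] by (simp add: add)
  moreover have "continuous_on UNIV (\<lambda>g. norm (\<alpha> g 0))"
    using continuous_on_affine_isometric_action[OF act] by (rule continuous_on_norm)
  ultimately show ?thesis
    by (simp add: length_on_def)
qed

text \<open>Multiplicativity of the linear part and the cocycle relation for the translations are
  what makes the block matrices of \<open>affine_rep\<close> multiply as a homomorphism.\<close>

lemma affine_linear_part:
  assumes act: "affine_isometric_action \<alpha>"
  shows affine_linear_part_clinear: "clinear_map (affine_linear_part \<alpha> g)"
    and norm_affine_linear_part: "norm (affine_linear_part \<alpha> g v) = norm v"
    and affine_linear_part_add: "affine_linear_part \<alpha> (g + h) v
      = affine_linear_part \<alpha> g (affine_linear_part \<alpha> h v)"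
    and affine_linear_part_cocycle: "\<alpha> (g + h) 0 = affine_linear_part \<alpha> g (\<alpha> h 0) + \<alpha> g 0"
proof -
  have add: "\<alpha> (g + h) v = \<alpha> g (\<alpha> h v)" and iso: "norm (\<alpha> g v - \<alpha> g w) = norm (v - w)" for g h v w
    using act by (simp_all add: affine_isometric_action_def flip: dist_norm)
  have cl: "clinear_map (affine_linear_part \<alpha> g)" for g
  proof -
    obtain L b where L: "clinear_map L" "\<And>v. \<alpha> g v = L v + b"
      using act unfolding affine_isometric_action_def by blast
    have "L 0 = 0"
      using L(1) unfolding clinear_map_def by (metis add_cancel_right_right)
    then have "affine_linear_part \<alpha> g = L"
      by (simp add: fun_eq_iff affine_linear_part_def L(2))
    with L(1) show ?thesis by simp
  qed
  then show "clinear_map (affine_linear_part \<alpha> g)" .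
  show "norm (affine_linear_part \<alpha> g v) = norm v"
    using iso[of g v 0] by (simp add: affine_linear_part_def)
  have "affine_linear_part \<alpha> g (affine_linear_part \<alpha> h v + \<alpha> h 0)
      = affine_linear_part \<alpha> g (affine_linear_part \<alpha> h v) + affine_linear_part \<alpha> g (\<alpha> h 0)"
    using cl[of g] by (simp add: clinear_map_def)
  then show "affine_linear_part \<alpha> (g + h) v = affine_linear_part \<alpha> g (affine_linear_part \<alpha> h v)"
    by (simp add: affine_linear_part_def add algebra_simps)
  show "\<alpha> (g + h) 0 = affine_linear_part \<alpha> g (\<alpha> h 0) + \<alpha> g 0"
    by (simp add: affine_linear_part_def add)
qed

lemma norm_affine_rep_le:
  assumes act: "affine_isometric_action \<alpha>" and s: "0 < s"
  shows "norm (affine_rep s \<alpha> g x) \<le> exp (s * norm (\<alpha> g 0)) * norm x"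
proof -
  \<comment> \<open>Splits off the diagonal part, which is isometric, from the off-diagonal part,
    which is small when s is.\<close>
  have "affine_rep s \<alpha> g x
      = (fst x, affine_linear_part \<alpha> g (snd x)) + (0, (of_real s * fst x) *\<^sub>C \<alpha> g 0)"
    by (simp add: affine_rep_def)
  also have "norm \<dots> \<le> norm (fst x, affine_linear_part \<alpha> g (snd x))
      + norm (0::complex, (of_real s * fst x) *\<^sub>C \<alpha> g 0)"
    by (rule norm_triangle_ineq)
  also have "norm (fst x, affine_linear_part \<alpha> g (snd x)) = norm x"
    by (simp add: norm_prod_def norm_affine_linear_part[OF act])
  also have "norm (0::complex, (of_real s * fst x) *\<^sub>C \<alpha> g 0) = s * norm (\<alpha> g 0) * cmod (fst x)"
    using s by (simp add: norm_prod_def norm_scaleC norm_mult)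
  also have "norm x + s * norm (\<alpha> g 0) * cmod (fst x) \<le> norm x + s * norm (\<alpha> g 0) * norm x"
    using s norm_fst_le[of "fst x" "snd x"] by (intro add_left_mono mult_left_mono) simp_all
  also have "\<dots> = (1 + s * norm (\<alpha> g 0)) * norm x"
    by (simp add: algebra_simps)
  also have "\<dots> \<le> exp (s * norm (\<alpha> g 0)) * norm x"
    by (intro mult_right_mono exp_ge_add_one_self) simp
  finally show ?thesis .
qed

lemma affine_rep_in_reps_bounded_by:
  fixes \<alpha> :: "'g::topological_group_add \<Rightarrow> 'x::complex_banach \<Rightarrow> 'x"
  assumes act: "affine_isometric_action \<alpha>" and s: "0 < s"
  shows "affine_rep s \<alpha> \<in> reps_bounded_by (\<lambda>g. s * norm (\<alpha> g 0))"
proof -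
  have lin: "affine_linear_part \<alpha> g (v + w) = affine_linear_part \<alpha> g v + affine_linear_part \<alpha> g w"
    "affine_linear_part \<alpha> g (c *\<^sub>C v) = c *\<^sub>C affine_linear_part \<alpha> g v" for g c v w
    using affine_linear_part_clinear[OF act] by (simp_all add: clinear_map_def)
  have "clinear_map (affine_rep s \<alpha> g)" for g
    unfolding clinear_map_def
    by (simp add: affine_rep_def scaleC_prod_def scaleC_complex_def lin scaleC_add_left
      scaleC_add_right scaleC_scaleC algebra_simps)
  then have "bounded_clinear_map (affine_rep s \<alpha> g)" for g
    using norm_affine_rep_le[OF act s] by (rule bounded_clinear_mapI)
  moreover have "affine_rep s \<alpha> 0 = id"
  proof -
    have "\<alpha> 0 = id"
      using act by (simp add: affine_isometric_action_def)
    then show ?thesis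
      by (simp add: fun_eq_iff affine_rep_def affine_linear_part_def
        bounded_bilinear.zero_right[OF bounded_bilinear_scaleC])
  qed
  moreover have "affine_rep s \<alpha> (g + h) = affine_rep s \<alpha> g \<circ> affine_rep s \<alpha> h" for g h
    by (simp add: fun_eq_iff affine_rep_def affine_linear_part_add[OF act]
      affine_linear_part_cocycle[OF act] lin scaleC_add_right add.assoc)
  moreover have "continuous_on UNIV (\<lambda>g. affine_rep s \<alpha> g x)" for x
    unfolding affine_rep_def affine_linear_part_def
    by (intro continuous_on_Pair continuous_on_add continuous_on_diff continuous_on_const
      bounded_bilinear.continuous_on[OF bounded_bilinear_scaleC]
      continuous_on_affine_isometric_action[OF act])
  moreover have "onorm (affine_rep s \<alpha> g) \<le> exp (s * norm (\<alpha> g 0))" for g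
    using norm_affine_rep_le[OF act s] by (intro onorm_bound) simp_all
  ultimately show ?thesis
    by (simp add: reps_bounded_by_def representation_def)
qed

section \<open>From an invariant vector to a fixed point\<close>

text \<open>The first coordinate is a bounded functional left unchanged by every operator of the
  representation, so pulling it through the integral leaves only the scalar weight f.\<close>

lemma fst_rep_op_affine_rep:
  fixes \<alpha> :: "'g::{topological_group_add, t2_space} \<Rightarrow> 'x::complex_banach \<Rightarrow> 'x"
  assumes "left_haar_measure \<mu>" and act: "affine_isometric_action \<alpha>" and s: "0 < s" and "f \<in> Cc"
  shows "fst (rep_op \<mu> (affine_rep s \<alpha>) f x) = (\<integral>g. f g \<partial>\<mu>) * fst x"
proof -
  have "representation (affine_rep s \<alpha>)"
    using affine_rep_in_reps_bounded_by[OF act s] by (simp add: reps_bounded_by_def)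
  from has_bochner_integral_in_bounded_linear[OF bounded_linear_fst
      has_bochner_integral_rep_op[OF assms(1) this assms(4), of x]]
  have int: "has_bochner_integral \<mu> (\<lambda>g. f g * fst x) (fst (rep_op \<mu> (affine_rep s \<alpha>) f x))"
    by (simp add: has_bochner_integral_in_iff scaleC_prod_def scaleC_complex_def affine_rep_def)
  show ?thesis
    using has_bochner_integral_integral_eq[OF int] by simp
qed

lemma affine_fixed_point:
  assumes act: "affine_isometric_action \<alpha>" and s: "0 < s"
    and inv: "(1, w) \<in> invariant_vectors (affine_rep s \<alpha>)"
  shows "\<alpha> g ((1 / s) *\<^sub>R w) = (1 / s) *\<^sub>R w"
proof -
  have "affine_linear_part \<alpha> g w + s *\<^sub>R \<alpha> g 0 = w"
    using inv by (simp add: invariant_vectors_def affine_rep_def scaleC_of_real)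
  then have "(1 / s) *\<^sub>R affine_linear_part \<alpha> g w + \<alpha> g 0 = (1 / s) *\<^sub>R w"
    using s by (metis (no_types, opaque_lifting) less_irrefl nonzero_divide_eq_eq scaleR_add_right
      scaleR_one scaleR_scaleR)
  moreover have "(1 / s) *\<^sub>R affine_linear_part \<alpha> g w = affine_linear_part \<alpha> g ((1 / s) *\<^sub>R w)"
    using affine_linear_part_clinear[OF act, of g]
    by (simp add: clinear_map_def flip: scaleC_of_real)
  ultimately show ?thesis
    by (simp add: affine_linear_part_def)
qed

theorem proposition1p9:
  fixes \<mu> :: "('g::{topological_group_add, t2_space}) measure"
  assumes "locally_compact_space (euclidean :: 'g topology)"
    and "left_haar_measure \<mu>"
    and "robust_banach_T \<mu> TYPE(complex \<times> 'x::complex_banach)"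
  shows "property_F TYPE('g) TYPE('x)"
  unfolding property_F_def
proof (intro allI impI)
  fix \<alpha> :: "'g \<Rightarrow> 'x \<Rightarrow> 'x"
  assume act: "affine_isometric_action \<alpha>"
  define l where "l g = norm (\<alpha> g 0)" for g
  have l: "length_on l"
    unfolding l_def using act by (rule length_on_displacement)
  obtain s :: real and f :: "nat \<Rightarrow> 'g \<Rightarrow> complex" and p where s: "0 < s"
    and f: "\<And>n. f n \<in> Cc" "\<And>n. (\<integral>g. f n g \<partial>\<mu>) = 1"
    and conv: "converges_in_completion Cc
      (family_dist \<mu> (reps_bounded_by (\<lambda>g. s * l g) :: ('g \<Rightarrow> complex \<times> 'x \<Rightarrow> complex \<times> 'x) set)) f p"
    and proj: "\<And>\<pi> :: 'g \<Rightarrow> complex \<times> 'x \<Rightarrow> complex \<times> 'x. \<pi> \<in> reps_bounded_by (\<lambda>g. s * l g) \<Longrightarrow>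
      projection_on (rep_ext \<mu> \<pi> p) (invariant_vectors \<pi>)"
    using assms(3) l unfolding robust_banach_T_def Let_def by blast
  let ?\<pi> = "affine_rep s \<alpha>"
  have \<pi>: "?\<pi> \<in> reps_bounded_by (\<lambda>g. s * l g)"
    unfolding l_def using act s by (rule affine_rep_in_reps_bounded_by)
  have sl: "continuous_on UNIV (\<lambda>g. s * l g)"
    using l by (intro continuous_on_mult_left) (simp add: length_on_def)
  have "(\<lambda>n. fst (rep_op \<mu> ?\<pi> (f n) (1, 0))) \<longlonglongrightarrow> fst (rep_ext \<mu> ?\<pi> p (1, 0))"
    by (intro tendsto_fst rep_op_tendsto_rep_ext[OF assms(2) sl \<pi> f(1) conv])
  then have "fst (rep_ext \<mu> ?\<pi> p (1, 0)) = 1"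
    by (simp add: fst_rep_op_affine_rep[OF assms(2) act s f(1)] f(2) LIMSEQ_const_iff)
  \<comment> \<open>A projection on the invariant vectors takes all its values there.\<close>
  moreover have "rep_ext \<mu> ?\<pi> p (1, 0) \<in> invariant_vectors ?\<pi>"
    using proj[OF \<pi>] by (auto simp: projection_on_def)
  ultimately have "(1, snd (rep_ext \<mu> ?\<pi> p (1, 0))) \<in> invariant_vectors ?\<pi>"
    by (metis prod.collapse)
  then show "\<exists>v. \<forall>g. \<alpha> g v = v"
    using affine_fixed_point[OF act s] by blast
qed

end
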